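(* For all integers $\Delta, m\ge 1$, $$\frac{1}{2}(m^2+m)+m(\Delta-1)\le \mathfrak{c}(\Delta,m).$$
   Context: A matrix is treated as the multiset of its columns. Two vectors $\mathbf{a},\overline{\mathbf{a}}\in\mathbb{R}^d$ differ if $\mathbf{a}\neq\pm\overline{\mathbf{a}}$. A multiset $X\subseteq\mathbb{R}^d$ has differing columns if every pair of vectors in $X$ differs and $\mathbf{0}\notin X$. The number of differing columns of a matrix $A$, i.e. the largest cardinality of a subset of the columns of $A$ that has differing columns, is denoted $|A|$. For an integer matrix $A$ with $m$ rows and $\operatorname{rank} A=m$, let $\Delta(A):=\max\{|\det B| : B \text{ is an } m\times m \text{ submatrix of } A\}$; $A$ is $\Delta$-modular if $\Delta(A)\le\Delta$. For integers $\Delta,m\ge 1$, $$\mathfrak{c}(\Delta,m):=\max\{|A| : A \text{ is an integer matrix with } m \text{ rows},\ \operatorname{rank}A=m,\ \Delta(A)\le\Delta\}.$$ *)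

theory Defs
  imports
    "HOL-Library.Multiset"
    "Jordan_Normal_Form.DL_Rank"
    "Jordan_Normal_Form.DL_Submatrix"
begin

definition differ :: "'a::ab_group_add vec \<Rightarrow> 'a vec \<Rightarrow> bool" where
  "differ a b \<longleftrightarrow> a \<noteq> b \<and> a \<noteq> - b"

(* A pair is a two-element submultiset, so a vector occurring twice violates the condition. *)
definition has_differing_columns :: "nat \<Rightarrow> 'a::ab_group_add vec multiset \<Rightarrow> bool" where
  "has_differing_columns d X \<longleftrightarrow>
     (\<forall>a b. {#a, b#} \<subseteq># X \<longrightarrow> differ a b) \<and> 0\<^sub>v d \<notin># X"

definition num_differing_columns :: "'a::ab_group_add mat \<Rightarrow> nat" where
  "num_differing_columns A =
     Max {size X | X. X \<subseteq># mset (cols A) \<and> has_differing_columns (dim_row A) X}"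

definition full_row_rank :: "int mat \<Rightarrow> bool" where
  "full_row_rank A \<longleftrightarrow> vec_space.rank (dim_row A) (map_mat real_of_int A) = dim_row A"

(* Only meaningful for full row rank: otherwise A may have no square submatrix of this size. *)
definition max_abs_minor :: "int mat \<Rightarrow> int" where
  "max_abs_minor A =
     Max {\<bar>det B\<bar> | B. B \<in> carrier_mat (dim_row A) (dim_row A) \<and>
                      (\<exists>I J. B = submatrix A I J)}"

definition modular :: "int \<Rightarrow> int mat \<Rightarrow> bool" where
  "modular \<Delta> A \<longleftrightarrow> max_abs_minor A \<le> \<Delta>"

(* The set is finite: expressing the columns of A in a basis B of columns with largest |det B|
   gives, by Cramer's rule, at most (2 \<Delta> + 1) ^ m distinct columns. *)
definition column_number :: "int \<Rightarrow> nat \<Rightarrow> nat" where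
  "column_number \<Delta> m =
     Max {num_differing_columns A | A. dim_row A = m \<and> full_row_rank A \<and> modular \<Delta> A}"

end

theory Submission
  imports Defs
begin

text \<open>
  The extremal matrix has as columns the indicator vectors of the intervals \<open>{i..<j}\<close> with
  \<open>i < j \<le> m\<close>, where for \<open>j = m\<close> the last coordinate is scaled by each of
  \<open>1, \<dots>, \<Delta>\<close> in turn. Intervals with \<open>j < m\<close> give \<open>m (m - 1) / 2\<close> columns and those with
  \<open>j = m\<close> give \<open>m \<Delta>\<close>, which is the required number. The vectors are nonzero, nonnegative and
  pairwise distinct, so any two of them differ, and the intervals of length one contribute the
  unit vectors, so the rank is \<open>m\<close>.

  Every minor is at most \<open>\<Delta>\<close> in absolute value (\<open>abs_det_weighted_interval_le\<close>). An
  \<open>m \<times> m\<close> determinant is linear in its last row, and the weights of the columns range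
  over the box \<open>[0, \<Delta>]\<close>, so the extreme values occur when each weight is \<open>0\<close> or \<open>\<Delta>\<close>. At such
  a vertex the determinant is \<open>\<Delta>\<close> times that of a 0/1 matrix whose columns are indicators of
  intervals, and determinants of the latter lie in \<open>{-1, 0, 1}\<close>
  (\<open>abs_det_interval_mat_le_1\<close>).

  The column number is a maximum over all \<open>\<Delta>\<close>-modular matrices of full row rank, so the
  set of attained values must also be shown to be bounded
  (\<open>num_differing_columns_le_column_number\<close>). Choose a nonsingular \<open>B\<close> among the columns of
  such a matrix. By Cramer's rule a column \<open>a\<close> is determined by the \<open>m\<close> determinants that
  arise from replacing a column of \<open>B\<close> by \<open>a\<close>. These are, up to sign, minors or zero, so they are
  integers in \<open>[-\<Delta>, \<Delta>]\<close>, and the number of distinct columns is bounded in terms of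
  \<open>\<Delta>\<close> and \<open>m\<close>.
\<close>

section \<open>Determinants of interval matrices\<close>

definition interval_mat :: "nat \<Rightarrow> (nat \<Rightarrow> nat) \<Rightarrow> (nat \<Rightarrow> nat) \<Rightarrow> int mat" where
  "interval_mat n l u = mat n n (\<lambda>(r, c). if l c \<le> r \<and> r < u c then 1 else 0)"

lemma interval_mat_carrier [simp]: "interval_mat n l u \<in> carrier_mat n n"
  by (simp add: interval_mat_def)

lemma mat_delete_interval_mat:
  assumes "c < Suc n"
  shows "mat_delete (interval_mat (Suc n) l u) 0 c =
    interval_mat n (\<lambda>d. l (insert_index c d) - 1) (\<lambda>d. u (insert_index c d) - 1)"
  using assms by (intro eq_matI) (auto simp: interval_mat_def mat_delete_def insert_index_def)

lemma addcol_interval_mat: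
  assumes "c < n" "d < n" "c \<noteq> d" "l c = 0" "l d = 0" "u c \<le> u d"
  shows "addcol (-1) d c (interval_mat n l u) = interval_mat n (l(d := u c)) u"
  using assms by (intro eq_matI) (auto simp: interval_mat_def)

text \<open>
  If two columns both start at row \<open>0\<close>, subtracting the shorter from the longer leaves an
  interval column and shortens the total length. Once at most one column meets row \<open>0\<close>,
  Laplace expansion along that row leaves at most one term, a smaller interval matrix.
\<close>

lemma abs_det_interval_mat_le_1: "\<bar>det (interval_mat n l u)\<bar> \<le> 1"
proof (induction n arbitrary: l u)
  case 0
  show ?case by (simp add: det_dim_zero[OF interval_mat_carrier])
next
  case (Suc n)
  note deletion = this
  show ?case
  proof (induction "\<Sum>c<Suc n. u c - l c" arbitrary: l rule: less_induct)
    case less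
    let ?A = "interval_mat (Suc n) l u"
    define S where "S = {c. c < Suc n \<and> l c = 0 \<and> 0 < u c}"
    have laplace: "det ?A = (\<Sum>c\<in>S. cofactor ?A 0 c)"
    proof -
      have "det ?A = (\<Sum>c<Suc n. ?A $$ (0, c) * cofactor ?A 0 c)"
        by (rule laplace_expansion_row) auto
      also have "\<dots> = (\<Sum>c\<in>S. cofactor ?A 0 c)"
        by (rule sum.mono_neutral_cong_right) (auto simp: S_def interval_mat_def)
      finally show ?thesis .
    qed
    show ?case
    proof (cases "\<exists>c d. c \<in> S \<and> d \<in> S \<and> c \<noteq> d")
      case True
      then obtain c d where cd: "c \<in> S" "d \<in> S" "c \<noteq> d" "u c \<le> u d"
        by (metis linear)
      let ?l = "l(d := u c)"
      have "(\<Sum>b<Suc n. u b - ?l b) < (\<Sum>b<Suc n. u b - l b)"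
      proof (rule sum_strict_mono_ex1)
        show "\<exists>b\<in>{..<Suc n}. u b - ?l b < u b - l b"
          using cd by (intro bexI[of _ d]) (auto simp: S_def)
      qed (use cd in \<open>auto simp: S_def\<close>)
      from less[OF this] have "\<bar>det (interval_mat (Suc n) ?l u)\<bar> \<le> 1" .
      moreover have "det (interval_mat (Suc n) ?l u) = det ?A"
        using cd by (simp add: S_def det_addcol[of _ "Suc n"] flip: addcol_interval_mat)
      ultimately show ?thesis by simp
    next
      case False
      then consider "S = {}" | c where "S = {c}" by blast
      then show ?thesis
      proof cases
        case 2
        then have "c < Suc n" by (auto simp: S_def)
        then show ?thesis
          using deletion by (simp add: laplace 2 cofactor_def mat_delete_interval_mat abs_mult)
      qed (simp add: laplace)
    qed
  qed
qed

section \<open>Weights on the last row\<close>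

definition weighted_interval_vec :: "nat \<Rightarrow> nat \<Rightarrow> nat \<Rightarrow> int \<Rightarrow> int vec" where
  "weighted_interval_vec m i j k =
     vec m (\<lambda>r. if i \<le> r \<and> r < j then (if Suc r = m then k else 1) else 0)"

text \<open>
  The cofactors of the last row do not involve the weights, so the determinant is a linear
  function of them and is largest (smallest) on the box when the weight is \<open>\<Delta>\<close> exactly where
  the coefficient is positive (negative) and \<open>0\<close> elsewhere. Dividing such weights by
  \<open>\<Delta>\<close> leaves an interval matrix, since weight \<open>0\<close> cuts the last row off the interval.
\<close>

lemma abs_det_weighted_interval_le:
  assumes k: "\<And>c. c < m \<Longrightarrow> 0 \<le> k c \<and> k c \<le> \<Delta>" and "0 < m" "1 \<le> \<Delta>"
  shows "\<bar>det (mat m m (\<lambda>(r, c). weighted_interval_vec m (l c) (u c) (k c) $ r))\<bar> \<le> \<Delta>"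
proof -
  define M where "M w = mat m m (\<lambda>(r, c). weighted_interval_vec m (l c) (u c) (w c) $ r)" for w
  have M: "M w \<in> carrier_mat m m" for w by (simp add: M_def)
  \<comment> \<open>The coefficient of the weight of column \<open>c\<close>, which is \<open>0\<close> if the interval misses the last row.\<close>
  define a where "a c = (if l c < m \<and> m \<le> u c then cofactor (M k) (m - 1) c else 0)" for c
  have cof: "cofactor (M w) (m - 1) c = cofactor (M k) (m - 1) c" if "c < m" for w c
  proof -
    have "mat_delete (M w) (m - 1) c = mat_delete (M k) (m - 1) c"
      using that by (intro eq_matI)
        (auto simp: M_def mat_delete_def weighted_interval_vec_def)
    then show ?thesis by (simp add: cofactor_def)
  qed
  have linear: "det (M w) = (\<Sum>c<m. w c * a c)" for w
  proof -
    have "det (M w) = (\<Sum>c<m. M w $$ (m - 1, c) * cofactor (M w) (m - 1) c)"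
      using \<open>0 < m\<close> by (intro laplace_expansion_row M) auto
    also have "\<dots> = (\<Sum>c<m. w c * a c)"
    proof (intro sum.cong refl)
      fix c assume "c \<in> {..<m}"
      then have "c < m" by simp
      then have "M w $$ (m - 1, c) = (if l c < m \<and> m \<le> u c then w c else 0)"
        using \<open>0 < m\<close> by (auto simp: M_def weighted_interval_vec_def)
      then show "M w $$ (m - 1, c) * cofactor (M w) (m - 1) c = w c * a c"
        using cof[OF \<open>c < m\<close>, of w] by (simp add: a_def)
    qed
    finally show ?thesis .
  qed
  have vertex: "\<bar>det (M (\<lambda>c. of_bool (P c)))\<bar> \<le> 1" for P
  proof -
    have "M (\<lambda>c. of_bool (P c)) =
        interval_mat m l (\<lambda>c. if P c then u c else min (u c) (m - 1))"
      by (intro eq_matI) (auto simp: M_def interval_mat_def weighted_interval_vec_def)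
    then show ?thesis by (simp add: abs_det_interval_mat_le_1)
  qed
  have "det (M k) \<le> (\<Sum>c<m. \<Delta> * (of_bool (0 < a c) * a c))"
    unfolding linear using k \<open>1 \<le> \<Delta>\<close>
    by (intro sum_mono) (auto intro: mult_right_mono mult_nonneg_nonpos)
  also have "\<dots> = \<Delta> * det (M (\<lambda>c. of_bool (0 < a c)))"
    unfolding linear sum_distrib_left ..
  also have "\<dots> \<le> \<Delta> * 1"
    using vertex \<open>1 \<le> \<Delta>\<close> by (intro mult_left_mono) (auto simp: abs_le_iff)
  finally have "det (M k) \<le> \<Delta>" by simp
  moreover have "- \<Delta> \<le> det (M k)"
  proof -
    have "- \<Delta> = \<Delta> * (- 1)" by simp
    also have "\<dots> \<le> \<Delta> * det (M (\<lambda>c. of_bool (a c < 0)))"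
      using vertex[of "\<lambda>c. a c < 0"] \<open>1 \<le> \<Delta>\<close> by (intro mult_left_mono) linarith+
    also have "\<dots> = (\<Sum>c<m. \<Delta> * (of_bool (a c < 0) * a c))"
      unfolding linear sum_distrib_left ..
    also have "\<dots> \<le> det (M k)"
      unfolding linear using k \<open>1 \<le> \<Delta>\<close>
      by (intro sum_mono) (auto intro: mult_right_mono_neg)
    finally show ?thesis .
  qed
  ultimately show ?thesis by (simp add: M_def abs_le_iff)
qed

section \<open>Minors as determinants of lists of columns\<close>

lemma abs_det_mat_of_cols_mset:
  fixes xs ys :: "'a :: linordered_idom vec list"
  assumes "mset xs = mset ys" "length ys = n"
  shows "\<bar>det (mat_of_cols n xs)\<bar> = \<bar>det (mat_of_cols n ys)\<bar>"
proof -
  have len: "length xs = n" using assms by (metis size_mset)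
  from mset_eq_permutation[OF assms(1)] obtain p
    where p: "p permutes {..<n}" "permute_list p ys = xs"
    using assms(2) by auto
  let ?Y = "(mat_of_cols n ys)\<^sup>T"
  have Y: "?Y \<in> carrier_mat n n" using assms(2) by (simp add: mat_of_cols_def)
  have "det (mat_of_cols n xs) = det ((mat_of_cols n xs)\<^sup>T)"
    using len by (intro det_transpose[symmetric, of _ n]) (simp add: mat_of_cols_def)
  also have "(mat_of_cols n xs)\<^sup>T = mat n n (\<lambda>(i, j). ?Y $$ (p i, j))"
    using p len assms(2) permutes_in_image[OF p(1)]
    by (intro eq_matI) (auto simp: mat_of_cols_def permute_list_nth simp flip: p(2))
  also have "det \<dots> = signof p * det ?Y"
    using p(1) by (intro det_permute_rows Y) (simp add: atLeast0LessThan)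
  also have "det ?Y = det (mat_of_cols n ys)"
    using assms(2) by (intro det_transpose[of _ n]) (simp add: mat_of_cols_def)
  finally show ?thesis by (simp add: abs_mult sign_def)
qed

text \<open>
  The index sets range over all sets of naturals, but only their indices within the
  dimensions of \<open>A\<close> matter.
\<close>

lemma finite_submatrices: "finite {submatrix A I J | I J. True}"
proof -
  have "submatrix A I J = submatrix A (I \<inter> {..<dim_row A}) (J \<inter> {..<dim_col A})" for I J
  proof -
    have pick_Int: "pick I i = pick (I \<inter> {..<d}) i" if "i < card {a. a < d \<and> a \<in> I}" for I d i
      using that pick_reduce_set[of i d I] by (simp add: Int_def conj_commute)
    show ?thesis
      by (intro eq_matI) (auto simp: submatrix_def Collect_conj_eq Int_ac pick_Int)
  qed
  then have "{submatrix A I J | I J. True} \<subseteq>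
      (\<lambda>(I, J). submatrix A I J) ` (Pow {..<dim_row A} \<times> Pow {..<dim_col A})"
    by (force simp: image_iff)
  then show ?thesis by (rule finite_subset) simp
qed

lemma finite_abs_minors:
  "finite {\<bar>det B\<bar> | B. B \<in> carrier_mat n n \<and> (\<exists>I J. B = submatrix (A :: int mat) I J)}"
  by (rule finite_subset[OF _ finite_imageI[OF finite_submatrices[of A], of "\<lambda>B. \<bar>det B\<bar>"]]) auto

lemma submatrix_UNIV_eq_mat_of_cols:
  "submatrix A UNIV J = mat_of_cols (dim_row A) (nths (cols A) J)"
  by (intro eq_matI)
    (auto simp: submatrix_def mat_of_cols_def length_nths pick_UNIV nth_nths conj_commute pick_le)

text \<open>
  A submatrix keeps the order of the columns, while \<open>vs\<close> lists columns in any order. As the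
  determinant is nonzero, \<open>vs\<close> has no repetition, so it is a permutation of the columns of some
  submatrix, and permuting columns changes only the sign.
\<close>

lemma abs_det_cols_le_max_abs_minor:
  assumes "set vs \<subseteq> set (cols A)" "length vs = dim_row A" "det (mat_of_cols (dim_row A) vs) \<noteq> 0"
  shows "\<bar>det (mat_of_cols (dim_row A) vs)\<bar> \<le> max_abs_minor A"
proof -
  let ?n = "dim_row A"
  have "distinct vs"
  proof (rule ccontr)
    assume "\<not> distinct vs"
    then obtain i j where ij: "i < ?n" "j < ?n" "i \<noteq> j" "vs ! i = vs ! j"
      using assms(2) by (auto simp: distinct_conv_nth)
    have "det (mat_of_cols ?n vs) = 0"
      using ij assms(2)
      by (intro det_identical_columns[of _ ?n i j])
         (auto simp: mat_of_cols_def intro!: eq_vecI)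
    with assms(3) show False by simp
  qed
  have "\<exists>J\<subseteq>{..<length (cols A)}. inj_on ((!) (cols A)) J \<and> set vs = (!) (cols A) ` J"
    using assms(1) by (intro subset_image_inj[THEN iffD1]) (auto simp: set_conv_nth)
  then obtain J where J: "J \<subseteq> {..<length (cols A)}" "inj_on ((!) (cols A)) J"
    "set vs = (!) (cols A) ` J" by blast
  let ?ws = "nths (cols A) J"
  have set_ws: "set ?ws = set vs" using J(1,3) by (auto simp: set_nths)
  have "length ?ws = card J"
    using J(1) by (auto simp: length_nths intro!: arg_cong[of _ _ card])
  also have "\<dots> = card (set ?ws)" using J by (simp add: set_ws card_image)
  finally have "distinct ?ws" by (simp add: card_distinct)
  then have mset: "mset vs = mset ?ws"
    using \<open>distinct vs\<close> set_ws by (metis set_eq_iff_mset_eq_distinct)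
  then have len: "length ?ws = ?n" using assms(2) by (metis size_mset)
  have "\<bar>det (mat_of_cols ?n vs)\<bar> = \<bar>det (submatrix A UNIV J)\<bar>"
    unfolding submatrix_UNIV_eq_mat_of_cols by (rule abs_det_mat_of_cols_mset[OF mset len])
  also have "\<dots> \<le> max_abs_minor A"
    unfolding max_abs_minor_def
    using len by (intro Max_ge finite_abs_minors)
      (auto simp: submatrix_UNIV_eq_mat_of_cols mat_of_cols_def intro!: exI[of _ "submatrix A UNIV J"])
  finally show ?thesis .
qed

text \<open>
  The bound on the dimensions ensures that a square submatrix with all rows exists, so that the
  maximum of the minors is taken over a nonempty set.
\<close>

lemma modularI:
  assumes "dim_row A \<le> dim_col A"
    and minors: "\<And>vs. \<lbrakk>set vs \<subseteq> set (cols A); length vs = dim_row A\<rbrakk> \<Longrightarrow>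
      \<bar>det (mat_of_cols (dim_row A) vs)\<bar> \<le> \<Delta>"
  shows "modular \<Delta> A"
proof -
  let ?n = "dim_row A"
  have "\<bar>det (submatrix A I J)\<bar> \<le> \<Delta>" if B: "submatrix A I J \<in> carrier_mat ?n ?n" for I J
  proof -
    have "card {i. i < ?n \<and> i \<in> I} = ?n" using carrier_matD(1)[OF B] by (simp add: dim_submatrix)
    then have "{i. i < ?n \<and> i \<in> I} = {..<?n}" by (intro card_subset_eq) auto
    then have "pick I r = r" if "r < ?n" for r
      using that pick_reduce_set[of r ?n I] pick_reduce_set[of r ?n UNIV]
      by (simp add: pick_UNIV lessThan_def)
    then have "submatrix A I J = submatrix A UNIV J"
      using B by (intro eq_matI) (auto simp: submatrix_def pick_UNIV)
    then have "submatrix A I J = mat_of_cols ?n (nths (cols A) J)"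
      by (simp add: submatrix_UNIV_eq_mat_of_cols)
    moreover from this have "length (nths (cols A) J) = ?n"
      using B by (metis carrier_matD(2) mat_of_cols_carrier(3))
    ultimately show ?thesis using minors[OF set_nths_subset] by simp
  qed
  moreover have "submatrix A UNIV {..<?n} \<in> carrier_mat ?n ?n"
  proof -
    have "{j. j < dim_col A \<and> j < ?n} = {..<?n}" using assms(1) by auto
    then show ?thesis by (simp add: submatrix_def)
  qed
  ultimately show ?thesis
    unfolding modular_def max_abs_minor_def by (subst Max_le_iff[OF finite_abs_minors]) auto
qed

section \<open>Boundedness of the number of columns\<close>

lemma det_replace_col_eq_adj_mat:
  assumes "B \<in> carrier_mat n n" "a \<in> carrier_vec n" "k < n"
  shows "det (replace_col B a k) = (adj_mat B *\<^sub>v a) $ k"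
proof -
  have R: "replace_col B a k \<in> carrier_mat n n" using assms(1) by (simp add: replace_col_def)
  have "mat_delete (replace_col B a k) i k = mat_delete B i k" if "i < n" for i
    using that assms by (intro eq_matI) (auto simp: replace_col_def mat_delete_def)
  then show ?thesis using assms
    unfolding laplace_expansion_column[OF R \<open>k < n\<close>]
    by (auto simp: scalar_prod_def atLeast0LessThan replace_col_def adj_mat_def cofactor_def
      mult.commute intro!: sum.cong)
qed

text \<open>
  This is the uniqueness part of Cramer's rule: the given determinants are the coordinates of
  \<open>a\<close> with respect to \<open>B\<close>, multiplied by \<open>det B\<close>. The argument applies \<open>B\<close> to the vector
  \<open>adj_mat B *\<^sub>v a\<close> that they form and so stays within the integral domain.
\<close>

lemma replace_col_inject:
  fixes B :: "'a :: idom mat"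
  assumes B: "B \<in> carrier_mat n n" and "det B \<noteq> 0"
    and ab: "a \<in> carrier_vec n" "b \<in> carrier_vec n"
    and eq: "\<And>k. k < n \<Longrightarrow> det (replace_col B a k) = det (replace_col B b k)"
  shows "a = b"
proof -
  have adj: "adj_mat B *\<^sub>v a = adj_mat B *\<^sub>v b"
    using eq B ab by (intro eq_vecI) (auto simp: det_replace_col_eq_adj_mat adj_mat_def)
  have scalar: "(c \<cdot>\<^sub>m 1\<^sub>m n) *\<^sub>v v = c \<cdot>\<^sub>v v" if "v \<in> carrier_vec n" for c :: 'a and v
  proof (rule eq_vecI)
    fix i assume "i < dim_vec (c \<cdot>\<^sub>v v)"
    then have "i < n" using that by simp
    then have "row (c \<cdot>\<^sub>m 1\<^sub>m n) i = c \<cdot>\<^sub>v unit_vec n i" by (intro eq_vecI) auto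
    then show "((c \<cdot>\<^sub>m 1\<^sub>m n) *\<^sub>v v) $ i = (c \<cdot>\<^sub>v v) $ i"
      using that \<open>i < n\<close> by (simp add: scalar_prod_left_unit)
  qed (use that in auto)
  have recover: "B *\<^sub>v (adj_mat B *\<^sub>v v) = det B \<cdot>\<^sub>v v" if "v \<in> carrier_vec n" for v
    using that assoc_mult_mat_vec[OF B adj_mat(1)[OF B] that]
    by (simp add: adj_mat(2)[OF B] scalar)
  have "det B \<cdot>\<^sub>v a = det B \<cdot>\<^sub>v b" using adj recover ab by metis
  then have "(det B \<cdot>\<^sub>v a) $ i = (det B \<cdot>\<^sub>v b) $ i" for i by simp
  then show ?thesis
    using ab \<open>det B \<noteq> 0\<close> by (intro eq_vecI) (auto, metis index_smult_vec(1) mult_left_cancel carrier_vecD)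
qed


text \<open>
  A maximal linearly independent set of real columns has as many elements as the rank, hence
  gives a square matrix of full rank. Its determinant is nonzero, and it is the image of an
  integer determinant.
\<close>

lemma full_row_rank_obtains_basis:
  assumes "full_row_rank A"
  obtains vs where "set vs \<subseteq> set (cols A)" "length vs = dim_row A"
    "det (mat_of_cols (dim_row A) vs) \<noteq> 0"
proof -
  let ?n = "dim_row A" and ?R = "map_mat real_of_int A"
  interpret vec_space "TYPE(real)" ?n .
  have R: "?R \<in> carrier_mat ?n (dim_col A)" by simp
  obtain U where U: "maximal U (\<lambda>T. T \<subseteq> set (cols ?R) \<and> lin_indpt T)"
    using maximal_exists_superset[of "set (cols ?R)" "\<lambda>T. T \<subseteq> set (cols ?R) \<and> lin_indpt T" "{}"]
      finite_lin_indpt2[of "{}"] by auto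
  then have sub: "U \<subseteq> set (cols ?R)" and li: "lin_indpt U" by (auto simp: maximal_def)
  have card: "card U = ?n"
    using rank_card_indpt[OF R U] assms by (simp add: full_row_rank_def)
  obtain us where us: "set us = U" "distinct us"
    using finite_distinct_list finite_subset[OF sub] by blast
  then have len: "length us = ?n" using card distinct_card by fastforce
  have "set us \<subseteq> carrier_vec ?n" using us(1) sub cols_dim[of ?R] by auto
  then have cols: "cols (mat_of_cols ?n us) = us" by simp
  have "mat_of_cols ?n us \<in> carrier_mat ?n ?n" using len by (simp add: mat_of_cols_def)
  then have det: "det (mat_of_cols ?n us) \<noteq> 0"
    using det_rank_iff lin_indpt_full_rank us li cols by metis
  have "set us \<subseteq> map_vec real_of_int ` set (cols A)"
    using us(1) sub by (auto simp: cols_def)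
  then have "\<forall>u\<in>set us. \<exists>v. v \<in> set (cols A) \<and> u = map_vec real_of_int v" by blast
  then obtain g where g: "\<forall>u\<in>set us. g u \<in> set (cols A) \<and> u = map_vec real_of_int (g u)"
    using bchoice by metis
  define vs where "vs = map g us"
  have vs: "set vs \<subseteq> set (cols A)" "us = map (map_vec real_of_int) vs"
    using g by (auto simp: vs_def intro!: map_idI[symmetric])
  have dims: "v \<in> carrier_vec ?n" if "v \<in> set vs" for v
    using that vs(1) cols_dim[of A] by blast
  have "mat_of_cols ?n us = map_mat real_of_int (mat_of_cols ?n vs)"
    using carrier_vecD[OF dims[OF nth_mem]]
    by (intro eq_matI) (auto simp: vs(2) mat_of_cols_def)
  then have "det (mat_of_cols ?n vs) \<noteq> 0"
    using det by (simp add: of_int_hom.hom_det)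
  moreover have "length vs = ?n" using len vs(2) by simp
  ultimately show ?thesis using that vs(1) by blast
qed

text \<open>
  No vector differs from itself, so a multiset with differing columns has no repeated element.
\<close>

lemma size_le_card_if_has_differing_columns:
  assumes "X \<subseteq># M" "has_differing_columns d X"
  shows "size X \<le> card (set_mset M)"
proof -
  have "count X x \<le> 1" for x
  proof (rule ccontr)
    assume "\<not> count X x \<le> 1"
    then have "{#x, x#} \<subseteq># X" by (auto simp: subseteq_mset_def)
    with assms(2) show False by (auto simp: has_differing_columns_def differ_def)
  qed
  then have "size X \<le> (\<Sum>x\<in>set_mset X. 1)"
    unfolding size_multiset_overloaded_eq by (intro sum_mono)
  also have "\<dots> \<le> card (set_mset M)"
    using set_mset_mono[OF assms(1)] by (simp add: card_mono)
  finally show ?thesis .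
qed

lemma finite_sizes_differing:
  "finite {size X | X. X \<subseteq># mset (cols A) \<and> has_differing_columns d X}"
  by (rule finite_subset[of _ "{..card (set (cols A))}"])
     (use size_le_card_if_has_differing_columns[of _ "mset (cols A)"] in auto)

lemma length_le_num_differing_columns:
  assumes "distinct (cols A)" "0\<^sub>v (dim_row A) \<notin> set (cols A)"
    and "\<And>a b. \<lbrakk>a \<in> set (cols A); b \<in> set (cols A); a \<noteq> b\<rbrakk> \<Longrightarrow> differ a b"
  shows "length (cols A) \<le> num_differing_columns A"
proof -
  have "differ a b" if ab: "{#a, b#} \<subseteq># mset (cols A)" for a b
  proof (rule assms(3))
    show "a \<in> set (cols A)" "b \<in> set (cols A)" using set_mset_mono[OF ab] by auto
    show "a \<noteq> b"
    proof
      assume "a = b"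
      then have "2 \<le> count (mset (cols A)) a" using mset_subset_eq_count[OF ab, of a] by simp
      then show False using assms(1) by (simp add: distinct_count_atmost_1 split: if_splits)
    qed
  qed
  then have "has_differing_columns (dim_row A) (mset (cols A))"
    using assms(2) by (simp add: has_differing_columns_def)
  then show ?thesis
    unfolding num_differing_columns_def
    by (intro Max_ge finite_sizes_differing) (auto intro!: exI[of _ "mset (cols A)"])
qed

lemma num_differing_columns_le_card:
  "num_differing_columns A \<le> card (set (cols A))"
proof -
  have "\<exists>X. X \<subseteq># mset (cols A) \<and> has_differing_columns (dim_row A) X"
    by (intro exI[of _ "{#}"]) (auto simp: has_differing_columns_def)
  then show ?thesis
    unfolding num_differing_columns_def
    using size_le_card_if_has_differing_columns[of _ "mset (cols A)"]
    by (subst Max_le_iff[OF finite_sizes_differing]) auto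
qed

lemma finite_bounded_int_vecs: "finite {v \<in> carrier_vec m. \<forall>k<m. \<bar>v $ k :: int\<bar> \<le> \<Delta>}"
proof (rule finite_subset)
  show "{v \<in> carrier_vec m. \<forall>k<m. \<bar>v $ k\<bar> \<le> \<Delta>} \<subseteq>
      vec_of_list ` {xs. set xs \<subseteq> {- \<Delta>..\<Delta>} \<and> length xs = m}"
  proof
    fix v assume v: "v \<in> {v \<in> carrier_vec m. \<forall>k<m. \<bar>v $ k\<bar> \<le> \<Delta>}"
    have "set (list_of_vec v) \<subseteq> {- \<Delta>..\<Delta>}"
      using v by (force simp: set_list_of_vec vec_set_def abs_le_iff)
    then show "v \<in> vec_of_list ` {xs. set xs \<subseteq> {- \<Delta>..\<Delta>} \<and> length xs = m}"
      using v by (intro image_eqI[of _ _ "list_of_vec v"]) (auto simp: vec_list)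
  qed
qed (simp add: finite_lists_length_eq)

text \<open>
  The columns inject into the vectors with entries in \<open>[-\<Delta>, \<Delta>]\<close>: a column \<open>a\<close> is sent to the
  determinants obtained by replacing each column of a fixed nonsingular choice \<open>B\<close> of columns
  by \<open>a\<close>. The bound depends on the matrix only through its number of rows.
\<close>

lemma card_cols_le_if_modular:
  assumes "full_row_rank A" "modular \<Delta> A" "0 \<le> \<Delta>"
  shows "card (set (cols A)) \<le>
    card {v \<in> carrier_vec (dim_row A). \<forall>k<dim_row A. \<bar>v $ k :: int\<bar> \<le> \<Delta>}"
proof -
  let ?n = "dim_row A"
  obtain vs where vs: "set vs \<subseteq> set (cols A)" "length vs = ?n"
    "det (mat_of_cols ?n vs) \<noteq> 0"
    using full_row_rank_obtains_basis[OF assms(1)] .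
  define B where "B = mat_of_cols ?n vs"
  have B: "B \<in> carrier_mat ?n ?n" using vs(2) by (simp add: B_def mat_of_cols_def)
  have dims: "v \<in> carrier_vec ?n" if "v \<in> set (cols A)" for v
    using that cols_dim[of A] by blast
  define \<phi> where "\<phi> a = vec ?n (\<lambda>k. det (replace_col B a k))" for a
  have bound: "\<bar>det (replace_col B a k)\<bar> \<le> \<Delta>" if a: "a \<in> set (cols A)" and k: "k < ?n" for a k
  proof -
    have "replace_col B a k = mat_of_cols ?n (vs[k := a])"
      using dims[OF a] vs(2) by (intro eq_matI)
        (auto simp: replace_col_def B_def mat_of_cols_def nth_list_update)
    moreover have "set (vs[k := a]) \<subseteq> set (cols A)"
      using vs(1) a set_update_subset_insert[of vs k a] by auto
    ultimately show ?thesis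
      using abs_det_cols_le_max_abs_minor[of "vs[k := a]" A] vs(2) assms(2,3)
      by (cases "det (replace_col B a k) = 0") (auto simp: modular_def)
  qed
  have "inj_on \<phi> (set (cols A))"
  proof
    fix a b assume ab: "a \<in> set (cols A)" "b \<in> set (cols A)" "\<phi> a = \<phi> b"
    have "det (replace_col B a k) = det (replace_col B b k)" if "k < ?n" for k
      using arg_cong[OF ab(3), of "\<lambda>v. v $ k"] that by (simp add: \<phi>_def)
    then show "a = b"
      using replace_col_inject[OF B _ dims dims] ab vs(3) by (auto simp: B_def)
  qed
  then show ?thesis
    by (rule card_inj_on_le[OF _ _ finite_bounded_int_vecs]) (auto simp: \<phi>_def bound)
qed

lemma num_differing_columns_le_column_number:
  assumes "full_row_rank A" "modular \<Delta> A" "0 \<le> \<Delta>"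
  shows "num_differing_columns A \<le> column_number \<Delta> (dim_row A)"
proof -
  let ?m = "dim_row A"
  let ?N = "card {v \<in> carrier_vec ?m. \<forall>k<?m. \<bar>v $ k :: int\<bar> \<le> \<Delta>}"
  have "num_differing_columns C \<le> ?N"
    if "dim_row C = ?m" "full_row_rank C" "modular \<Delta> C" for C
    using order_trans[OF num_differing_columns_le_card card_cols_le_if_modular[OF that(2,3) assms(3)]]
    by (simp only: that(1))
  then have "{num_differing_columns C | C. dim_row C = ?m \<and> full_row_rank C \<and> modular \<Delta> C} \<subseteq> {..?N}"
    by blast
  then have "finite {num_differing_columns C | C. dim_row C = ?m \<and> full_row_rank C \<and> modular \<Delta> C}"
    by (rule finite_subset) simp
  then show ?thesis
    unfolding column_number_def using assms(1,2) by (intro Max_ge) blast+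
qed

section \<open>The extremal matrix\<close>

lemma full_row_rank_if_unit_vecs:
  assumes "\<And>i. i < dim_row A \<Longrightarrow> unit_vec (dim_row A) i \<in> set (cols A)"
  shows "full_row_rank A"
proof -
  let ?n = "dim_row A" and ?R = "map_mat real_of_int A"
  interpret vec_space "TYPE(real)" ?n .
  have R: "?R \<in> carrier_mat ?n (dim_col A)" by simp
  have sub: "set (unit_vecs ?n) \<subseteq> set (cols ?R)"
  proof
    fix v :: "real vec" assume "v \<in> set (unit_vecs ?n)"
    then obtain i where i: "i < ?n" "v = unit_vec ?n i" by (auto simp: unit_vecs_def)
    then have "v = map_vec real_of_int (unit_vec ?n i)" by (intro eq_vecI) (auto simp: unit_vec_def)
    then show "v \<in> set (cols ?R)" using assms[OF i(1)] by (auto simp: cols_def)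
  qed
  have "lin_indpt (set (unit_vecs ?n))" using unit_vecs_basis by (simp add: basis_def)
  then have "card (set (unit_vecs ?n :: real vec list)) \<le> rank ?R" by (rule rank_ge_card_indpt[OF R sub])
  then have "?n \<le> rank ?R" by (simp add: distinct_card unit_vecs_distinct)
  moreover have "rank ?R \<le> ?n"
  proof -
    obtain U where U: "maximal U (\<lambda>T. T \<subseteq> set (cols ?R) \<and> lin_indpt T)"
      using maximal_exists_superset[of "set (cols ?R)" "\<lambda>T. T \<subseteq> set (cols ?R) \<and> lin_indpt T" "{}"]
        finite_lin_indpt2[of "{}"] by auto
    then have "U \<subseteq> carrier_vec ?n" "lin_indpt U" using cols_dim[of ?R] by (auto simp: maximal_def)
    then show ?thesis using li_le_dim(2)[of U] rank_card_indpt[OF R U] dim_is_n by simp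
  qed
  ultimately show ?thesis by (simp add: full_row_rank_def)
qed

text \<open>
  The triple \<open>(j, i, k)\<close> stands for the interval \<open>{i..<j}\<close> with weight \<open>k\<close>. An interval
  that misses the last row is given weight \<open>1\<close> only, so that every column is indexed once.
\<close>

definition interval_index :: "nat \<Rightarrow> nat \<Rightarrow> (nat \<times> nat \<times> nat) set" where
  "interval_index m D = (SIGMA j:{1..m}. {..<j} \<times> {1..if j = m then D else 1})"

definition interval_cols :: "nat \<Rightarrow> nat \<Rightarrow> int vec set" where
  "interval_cols m D = (\<lambda>(j, i, k). weighted_interval_vec m i j (int k)) ` interval_index m D"

lemma card_interval_index:
  assumes "1 \<le> m" "1 \<le> D"
  shows "2 * card (interval_index m D) = m * m + m + 2 * m * (D - 1)"
proof -
  have "card (interval_index m D) = (\<Sum>j=1..m. j * (if j = m then D else 1))"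
    by (simp add: interval_index_def)
  also have "\<dots> = (\<Sum>j=1..m. j + (if j = m then m * (D - 1) else 0))"
    using assms by (intro sum.cong) (auto simp: algebra_simps diff_mult_distrib2)
  also have "\<dots> = \<Sum>{1..m} + m * (D - 1)"
    using assms by (simp add: sum.distrib)
  finally show ?thesis
    using double_gauss_sum_from_Suc_0[of m, where 'a = nat] by (simp add: algebra_simps)
qed

lemma abs_det_interval_cols_le:
  assumes vs: "set vs \<subseteq> interval_cols m D" "length vs = m" and "1 \<le> m" "1 \<le> D"
  shows "\<bar>det (mat_of_cols m vs)\<bar> \<le> int D"
proof -
  have "\<exists>u l k. (u, l, k) \<in> interval_index m D \<and> vs ! c = weighted_interval_vec m l u (int k)"
    if "c < m" for c
  proof -
    have "vs ! c \<in> interval_cols m D" using that vs by auto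
    then show ?thesis by (auto simp: interval_cols_def)
  qed
  then obtain u l k where idx: "\<And>c. c < m \<Longrightarrow> (u c, l c, k c) \<in> interval_index m D"
    and nth: "\<And>c. c < m \<Longrightarrow> vs ! c = weighted_interval_vec m (l c) (u c) (int (k c))"
    by metis
  have "mat_of_cols m vs = mat m m (\<lambda>(r, c). weighted_interval_vec m (l c) (u c) (int (k c)) $ r)"
    using vs(2) nth by (intro eq_matI) (auto simp: mat_of_cols_def)
  moreover have "0 \<le> int (k c) \<and> int (k c) \<le> int D" if "c < m" for c
    using idx[OF that] \<open>1 \<le> D\<close> by (auto simp: interval_index_def split: if_splits)
  ultimately show ?thesis
    using abs_det_weighted_interval_le[of m "\<lambda>c. int (k c)" "int D" l u] \<open>1 \<le> m\<close> \<open>1 \<le> D\<close> by simp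
qed

text \<open>
  The support of the vector is the interval, and for \<open>j = m\<close> the weight is its last entry.
\<close>

lemma inj_on_weighted_interval_vec:
  "inj_on (\<lambda>(j, i, k). weighted_interval_vec m i j (int k)) (interval_index m D)"
proof (rule inj_onI, clarsimp)
  fix j i k j' i' k'
  assume mem: "(j, i, k) \<in> interval_index m D" "(j', i', k') \<in> interval_index m D"
    and eq: "weighted_interval_vec m i j (int k) = weighted_interval_vec m i' j' (int k')"
  have supp: "{i..<j} = {r. r < m \<and> weighted_interval_vec m i j (int k) $ r \<noteq> 0}"
    if "(j, i, k) \<in> interval_index m D" for j i k
    using that by (auto simp: interval_index_def weighted_interval_vec_def split: if_splits)
  have "{i..<j} = {i'..<j'}" using supp[OF mem(1)] supp[OF mem(2)] eq by simp
  then have ij: "i = i'" "j = j'"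
    using mem by (auto simp: interval_index_def atLeastLessThan_eq_iff)
  moreover have "k = k'"
  proof (cases "j = m")
    case True
    then show ?thesis
      using arg_cong[OF eq, of "\<lambda>v. v $ (m - 1)"] mem ij
      by (auto simp: interval_index_def weighted_interval_vec_def split: if_splits)
  next
    case False
    then show ?thesis using mem ij by (auto simp: interval_index_def)
  qed
  ultimately show "j = j' \<and> i = i' \<and> k = k'" by simp
qed

lemma interval_cols_nonneg:
  assumes "v \<in> interval_cols m D"
  shows "v \<in> carrier_vec m" "\<forall>r<m. 0 \<le> v $ r" "\<exists>r<m. 0 < v $ r"
proof -
  obtain j i k where idx: "(j, i, k) \<in> interval_index m D"
    and v: "v = weighted_interval_vec m i j (int k)"
    using assms by (auto simp: interval_cols_def)
  show "v \<in> carrier_vec m" "\<forall>r<m. 0 \<le> v $ r" by (auto simp: v weighted_interval_vec_def)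
  have "i < m" "0 < v $ i"
    using idx by (auto simp: v interval_index_def weighted_interval_vec_def)
  then show "\<exists>r<m. 0 < v $ r" by blast
qed

lemma zero_notin_interval_cols: "0\<^sub>v m \<notin> interval_cols m D"
  using interval_cols_nonneg(3) by fastforce

lemma differ_interval_cols:
  assumes "a \<in> interval_cols m D" "b \<in> interval_cols m D" "a \<noteq> b"
  shows "differ a b"
proof -
  obtain r where r: "r < m" "0 < a $ r" using interval_cols_nonneg(3)[OF assms(1)] by blast
  moreover have "(- b) $ r \<le> 0" using r(1) interval_cols_nonneg(1,2)[OF assms(2)] by auto
  ultimately show ?thesis using assms(3) by (auto simp: differ_def)
qed

theorem proposition1:
  fixes \<Delta> :: int and m :: nat
  assumes "\<Delta> \<ge> 1" and "m \<ge> 1"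
  shows "1 / 2 * (real m ^ 2 + real m) + real m * (real_of_int \<Delta> - 1)
           \<le> real (column_number \<Delta> m)"
proof -
  define D where "D = nat \<Delta>"
  have D: "1 \<le> D" "int D = \<Delta>" using assms(1) by (auto simp: D_def)
  have "finite (interval_cols m D)" by (simp add: interval_cols_def interval_index_def)
  then obtain vs where vs: "set vs = interval_cols m D" "distinct vs"
    using finite_distinct_list by blast
  define A where "A = mat_of_cols m vs"
  have carrier: "set vs \<subseteq> carrier_vec m"
    by (auto simp: vs interval_cols_def weighted_interval_vec_def)
  then have cols: "cols A = vs" by (simp add: A_def)
  have dim: "dim_row A = m" by (simp add: A_def)
  have unit: "unit_vec m i \<in> set (cols A)" if "i < m" for i
  proof -
    have "unit_vec m i = weighted_interval_vec m i (Suc i) (int 1)"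
      by (intro eq_vecI) (auto simp: unit_vec_def weighted_interval_vec_def)
    moreover have "(Suc i, i, 1) \<in> interval_index m D"
      using that D by (auto simp: interval_index_def)
    ultimately show ?thesis by (force simp: cols vs interval_cols_def)
  qed
  have rank: "full_row_rank A" by (rule full_row_rank_if_unit_vecs) (simp add: dim unit)
  have card: "length vs = card (interval_index m D)"
    using vs distinct_card[OF vs(2)] card_image[OF inj_on_weighted_interval_vec[of m D]]
    by (simp add: interval_cols_def)
  have "2 * m \<le> 2 * card (interval_index m D)"
    using card_interval_index[OF assms(2) D(1)] le_square[of m] by linarith
  then have "modular \<Delta> A"
    using abs_det_interval_cols_le[of _ m D] assms(2) D vs(1) cols card
    by (intro modularI) (simp_all add: A_def)
  have "length vs \<le> num_differing_columns A"
    using length_le_num_differing_columns[of A] cols vs differ_interval_cols[of _ m D]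
      zero_notin_interval_cols[of m D] dim by (simp del: cols_length)
  then have "card (interval_index m D) \<le> column_number \<Delta> m"
    using card num_differing_columns_le_column_number[OF rank \<open>modular \<Delta> A\<close>] assms(1) dim by simp
  then have "2 * real (card (interval_index m D)) \<le> 2 * real (column_number \<Delta> m)" by simp
  moreover have "2 * real (card (interval_index m D)) = real (m * m + m + 2 * m * (D - 1))"
    using card_interval_index[OF assms(2) D(1)] by (metis of_nat_mult of_nat_numeral)
  ultimately have "real (m * m + m + 2 * m * (D - 1)) \<le> 2 * real (column_number \<Delta> m)" by simp
  moreover have "real_of_int \<Delta> - 1 = real (D - 1)" using D by (simp add: of_nat_diff flip: D(2))
  ultimately show ?thesis by (simp add: power2_eq_square field_simps)
qed

end
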